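(* In the multi-term composite minimization setting of the context, assume B1, B2, C and that $\rho_k\ge G_k+H_k$ for $1\le k\le K$. Then: (i) The optimal value $\widehat{\mathrm{Opt}}$ of the penalized problem $$\widehat{\mathrm{Opt}}=\min_{\{[y^k;\tau^k]\in Y_k^+\}_{k=0}^K}\ \max_{\{[z^k;\sigma^k]\in Z_k^+\}_{k=0}^K}\Big\{\sum_{k=0}^K[\phi_k(y^k,z^k)+\tau^k-\sigma^k]+\sum_{k=1}^K\rho_k\pi_k^*(y^k-A_ky^0-b_k)\Big\}$$ coincides with the optimal value of the problem of interest $$\mathrm{Opt}=\min_{y^0\in Y_0}\Big\{f(y^0):=\sum_{k=0}^K[\psi_k(A_ky^0+b_k)+\Psi_k(A_ky^0+b_k)]\Big\}.$$ (ii) Consequently, if $\overline x=[\overline x^1;\overline x^2]$ with $\overline x^1=\{[\overline y^k;\overline\tau^k]\}_{k=0}^K\in X_1$, $\overline x^2\in X_2$, is a feasible solution of the saddle point problem $\min_{x^1\in X_1}\max_{x^2\in X_2}\Phi(x^1,x^2)$, then the correction $\widehat x^1=\{[\widehat y^k;\widehat\tau^k]\}_{k=0}^K$ of $\overline x^1$, given by $$\widehat y^0=\overline y^0,\qquad \widehat y^k=A_k\overline y^0+b_k\ (1\le k\le K),\qquad \widehat\tau^k=\Psi_k(\widehat y^k)\ (0\le k\le K),$$ is a feasible solution to the linearly constrained reformulation of the problem of interest (that is, $[\widehat y^k;\widehat\tau^k]\in Y_k^+$ for $0\le k\le K$ and $\widehat y^k=A_k\widehat y^0+b_k$ for $1\le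 k\le K$), and $$f(\widehat y^0)-\mathrm{Opt}\le\epsilon_{\rm Sad}(\overline x|X_1,X_2,\Phi).$$
   Context: Setting. $K$ is a nonnegative integer. For $0\le k\le K$: $E_k,\overline E_k$ are Euclidean spaces with nonempty closed convex subsets $Y_k\subset E_k$, $Z_k\subset\overline E_k$; $p_k(\cdot)$ is a norm on $E_k$ and $q_k(\cdot)$ a norm on $\overline E_k$, and $Y_k$, $Z_k$ are equipped with continuously differentiable convex functions $\omega_k:Y_k\to\mathbf R$, $\overline\omega_k:Z_k\to\mathbf R$, strongly convex with modulus 1 w.r.t. $p_k$, $q_k$, respectively; $y^0\mapsto A_ky^0+b_k:E_0\to E_k$ are affine mappings, the one with $k=0$ being the identity on $E_0$; $\psi_k:Y_k\to\mathbf R$ are Lipschitz continuous convex functions with saddle point representations $$\psi_k(y^k)=\sup_{z^k\in Z_k}[\phi_k(y^k,z^k)-\overline\Psi_k(z^k)],$$ where $\phi_k:Y_k\times Z_k\to\mathbf R$ are smooth (with Lipschitz continuous gradients), convex in $y^k$ and concave in $z^k$, and $\overline\Psi_k:Z_k\to\mathbf R$ are Lipschitz continuous convex; $\Psi_k:Y_k\to\mathbf R$ are Lipschitz continuous convex. For $1\le k\le K$, $\pi_k^*(\cdot)$ is a norm on $E_k$ with conjugate norm $\pi_k(\cdot)$, $W_k=\{w^k\in E_k:\pi_k(w^k)\le1\}$, $W_k$ is equipped with a continuously differentiable function $\widehat\omega_k:W_k\to\mathbf R$ strongly convex with modulus 1 w.r.t. $\pi_k$, and $\rho_k>0$ is a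 real. Sets: $Y_k^+=\{[y^k;\tau^k]:y^k\in Y_k,\ \tau^k\ge\Psi_k(y^k)\}\subset E_k\times\mathbf R$, $Z_k^+=\{[z^k;\sigma^k]:z^k\in Z_k,\ \sigma^k\ge\overline\Psi_k(z^k)\}\subset\overline E_k\times\mathbf R$, $0\le k\le K$; $X_1=Y_0^+\times\cdots\times Y_K^+$, $X_2=Z_0^+\times\cdots\times Z_K^+\times W_1\times\cdots\times W_K$. For $x^1=\{[y^k;\tau^k]\}_{k=0}^K\in X_1$ and $x^2=[\{[z^k;\sigma^k]\}_{k=0}^K;\{w^k\}_{k=1}^K]\in X_2$, $$\Phi(x^1,x^2)=\sum_{k=0}^K[\phi_k(y^k,z^k)+\tau^k-\sigma^k]+\sum_{k=1}^K\rho_k\langle w^k,y^k-A_ky^0-b_k\rangle,$$ so that the penalized problem is $\widehat{\mathrm{Opt}}=\min_{x^1\in X_1}\max_{x^2\in X_2}\Phi(x^1,x^2)$. Also $\epsilon_{\rm Sad}([x^1;x^2]|X_1,X_2,\Phi)=\sup_{\xi^2\in X_2}\Phi(x^1,\xi^2)-\inf_{\xi^1\in X_1}\Phi(\xi^1,x^2)$. Assumptions. B1: $A_kY_0+b_k\subset Y_k$ for $1\le k\le K$. B2: the sets $Z_k$, $0\le k\le K$, are bounded; the functions $\Psi_k$ are bounded below on $Y_k$; and the functions $f_k=\psi_k+\Psi_k$ are coercive on $Y_k$: whenever $y^k_t\in Y_k$, $t=1,2,\dots$, are such that $p_k(y^k_t)\to\infty$ as $t\to\infty$, one has $f_k(y^k_t)\to\infty$.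 C: for $1\le k\le K$, $\psi_k$ is Lipschitz continuous on $Y_k$ with constant $G_k$ w.r.t. $\pi_k^*(\cdot)$, and $\Psi_k$ is Lipschitz continuous on $Y_k$ with constant $H_k$ w.r.t. $\pi_k^*(\cdot)$. *)

theory Defs
  imports "HOL-Analysis.Analysis"
begin

text \<open>A finite family of Euclidean spaces of possibly different dimensions is rendered as a family of
  linear subspaces of one ambient Euclidean space, which is no restriction. Maps and functions on these
  subspaces (or on subsets of them) are total, and only their values there matter. Optimal values are
  infima and suprema in the extended reals.\<close>

definition norm_on_subspace :: "'a::real_vector set \<Rightarrow> ('a \<Rightarrow> real) \<Rightarrow> bool"
  where "norm_on_subspace E n \<longleftrightarrow>
    (\<forall>x\<in>E. 0 \<le> n x \<and> (n x = 0 \<longleftrightarrow> x = 0)) \<and>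
    (\<forall>x\<in>E. \<forall>c. n (c *\<^sub>R x) = \<bar>c\<bar> * n x) \<and>
    (\<forall>x\<in>E. \<forall>y\<in>E. n (x + y) \<le> n x + n y)"

definition conjugate_norm :: "'a::real_inner set \<Rightarrow> ('a \<Rightarrow> real) \<Rightarrow> 'a \<Rightarrow> real"
  where "conjugate_norm E n w = (SUP y\<in>{y \<in> E. n y \<le> 1}. w \<bullet> y)"

definition lipschitz_wrt :: "real \<Rightarrow> ('a::real_vector \<Rightarrow> real) \<Rightarrow> 'a set \<Rightarrow> ('a \<Rightarrow> real) \<Rightarrow> bool"
  where "lipschitz_wrt C n S f \<longleftrightarrow> 0 \<le> C \<and> (\<forall>x\<in>S. \<forall>y\<in>S. \<bar>f x - f y\<bar> \<le> C * n (x - y))"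

definition strongly_convex_on :: "'a::real_vector set \<Rightarrow> ('a \<Rightarrow> real) \<Rightarrow> real \<Rightarrow> ('a \<Rightarrow> real) \<Rightarrow> bool"
  where "strongly_convex_on S n \<mu> f \<longleftrightarrow> convex S \<and>
    (\<forall>x\<in>S. \<forall>y\<in>S. \<forall>u\<ge>0. \<forall>v\<ge>0. u + v = 1 \<longrightarrow>
      f (u *\<^sub>R x + v *\<^sub>R y) \<le> u * f x + v * f y - \<mu> / 2 * u * v * (n (x - y))\<^sup>2)"

text \<open>The sets below may have empty interior, in which case a gradient is not unique; as usual in
  that situation, smoothness asks for a gradient field with the stated regularity, the derivative
  being taken within the set.\<close>

definition gradient_field_on :: "'a::real_inner set \<Rightarrow> ('a \<Rightarrow> real) \<Rightarrow> ('a \<Rightarrow> 'a) \<Rightarrow> bool"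
  where "gradient_field_on S f g \<longleftrightarrow> (\<forall>x\<in>S. (f has_derivative (\<lambda>h. g x \<bullet> h)) (at x within S))"

definition continuously_differentiable_on :: "'a::real_inner set \<Rightarrow> ('a \<Rightarrow> real) \<Rightarrow> bool"
  where "continuously_differentiable_on S f \<longleftrightarrow> (\<exists>g. gradient_field_on S f g \<and> continuous_on S g)"

definition lipschitz_gradient_on :: "'a::real_inner set \<Rightarrow> ('a \<Rightarrow> real) \<Rightarrow> bool"
  where "lipschitz_gradient_on S f \<longleftrightarrow> (\<exists>g L. gradient_field_on S f g \<and> L-lipschitz_on S g)"

definition primal_domain :: "nat \<Rightarrow> (nat \<Rightarrow> 'a set) \<Rightarrow> (nat \<Rightarrow> 'a \<Rightarrow> real) \<Rightarrow> (nat \<Rightarrow> 'a \<times> real) set"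
  where "primal_domain K Y \<Psi> = (\<Pi>\<^sub>E k\<in>{..K}. epigraph (Y k) (\<Psi> k))"

definition dual_domain ::
  "nat \<Rightarrow> (nat \<Rightarrow> 'b set) \<Rightarrow> (nat \<Rightarrow> 'b \<Rightarrow> real) \<Rightarrow> (nat \<Rightarrow> 'a set) \<Rightarrow>
    ((nat \<Rightarrow> 'b \<times> real) \<times> (nat \<Rightarrow> 'a)) set"
  where "dual_domain K Z \<Psi>' W = (\<Pi>\<^sub>E k\<in>{..K}. epigraph (Z k) (\<Psi>' k)) \<times> (\<Pi>\<^sub>E k\<in>{1..K}. W k)"

definition saddle_function ::
  "nat \<Rightarrow> (nat \<Rightarrow> 'a \<Rightarrow> 'a) \<Rightarrow> (nat \<Rightarrow> 'a::real_inner) \<Rightarrow> (nat \<Rightarrow> 'a \<Rightarrow> 'b \<Rightarrow> real) \<Rightarrow> (nat \<Rightarrow> real) \<Rightarrow>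
    (nat \<Rightarrow> 'a \<times> real) \<Rightarrow> (nat \<Rightarrow> 'b \<times> real) \<times> (nat \<Rightarrow> 'a) \<Rightarrow> real"
  where "saddle_function K A b \<phi> \<rho> x1 x2 =
    (\<Sum>k\<le>K. \<phi> k (fst (x1 k)) (fst (fst x2 k)) + snd (x1 k) - snd (fst x2 k)) +
    (\<Sum>k=1..K. \<rho> k * (snd x2 k \<bullet> (fst (x1 k) - A k (fst (x1 0)) - b k)))"

definition saddle_gap :: "'x set \<Rightarrow> 'y set \<Rightarrow> ('x \<Rightarrow> 'y \<Rightarrow> real) \<Rightarrow> 'x \<Rightarrow> 'y \<Rightarrow> ereal"
  where "saddle_gap X1 X2 F x1 x2 = (SUP \<xi>2\<in>X2. ereal (F x1 \<xi>2)) - (INF \<xi>1\<in>X1. ereal (F \<xi>1 x2))"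

definition composite_objective ::
  "nat \<Rightarrow> (nat \<Rightarrow> 'a \<Rightarrow> 'a) \<Rightarrow> (nat \<Rightarrow> 'a::real_vector) \<Rightarrow> (nat \<Rightarrow> 'a \<Rightarrow> real) \<Rightarrow> (nat \<Rightarrow> 'a \<Rightarrow> real) \<Rightarrow>
    'a \<Rightarrow> real"
  where "composite_objective K A b \<psi> \<Psi> y0 = (\<Sum>k\<le>K. \<psi> k (A k y0 + b k) + \<Psi> k (A k y0 + b k))"

definition composite_opt ::
  "nat \<Rightarrow> (nat \<Rightarrow> 'a \<Rightarrow> 'a) \<Rightarrow> (nat \<Rightarrow> 'a::real_vector) \<Rightarrow> (nat \<Rightarrow> 'a set) \<Rightarrow> (nat \<Rightarrow> 'a \<Rightarrow> real) \<Rightarrow>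
    (nat \<Rightarrow> 'a \<Rightarrow> real) \<Rightarrow> ereal"
  where "composite_opt K A b Y \<psi> \<Psi> = (INF y0\<in>Y 0. ereal (composite_objective K A b \<psi> \<Psi> y0))"

definition penalized_opt ::
  "nat \<Rightarrow> (nat \<Rightarrow> 'a \<Rightarrow> 'a) \<Rightarrow> (nat \<Rightarrow> 'a::real_vector) \<Rightarrow> (nat \<Rightarrow> 'a set) \<Rightarrow> (nat \<Rightarrow> 'b set) \<Rightarrow>
    (nat \<Rightarrow> 'a \<Rightarrow> 'b \<Rightarrow> real) \<Rightarrow> (nat \<Rightarrow> 'a \<Rightarrow> real) \<Rightarrow> (nat \<Rightarrow> 'b \<Rightarrow> real) \<Rightarrow> (nat \<Rightarrow> real) \<Rightarrow>
    (nat \<Rightarrow> 'a \<Rightarrow> real) \<Rightarrow> ereal"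
  where "penalized_opt K A b Y Z \<phi> \<Psi> \<Psi>' \<rho> n =
    (INF x1\<in>(\<Pi>\<^sub>E k\<in>{..K}. epigraph (Y k) (\<Psi> k)). SUP x2\<in>(\<Pi>\<^sub>E k\<in>{..K}. epigraph (Z k) (\<Psi>' k)).
      ereal ((\<Sum>k\<le>K. \<phi> k (fst (x1 k)) (fst (x2 k)) + snd (x1 k) - snd (x2 k)) +
             (\<Sum>k=1..K. \<rho> k * n k (fst (x1 k) - A k (fst (x1 0)) - b k))))"

definition correction ::
  "nat \<Rightarrow> (nat \<Rightarrow> 'a \<Rightarrow> 'a) \<Rightarrow> (nat \<Rightarrow> 'a::real_vector) \<Rightarrow> (nat \<Rightarrow> 'a \<Rightarrow> real) \<Rightarrow>
    (nat \<Rightarrow> 'a \<times> real) \<Rightarrow> nat \<Rightarrow> 'a \<times> real"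
  where "correction K A b \<Psi> x1 =
    (\<lambda>k\<in>{..K}. let y0 = fst (x1 0); y = (if k = 0 then y0 else A k y0 + b k) in (y, \<Psi> k y))"

end

theory Submission
  imports Defs
begin

text \<open>Two mechanisms drive the proof. For a fixed primal point, the inner maximization separates over
  \<open>k\<close>: the supremum over \<open>[z\<^sup>k;\<sigma>\<^sup>k]\<close> is approached on the graph of the function defining
  the epigraph and reproduces \<open>\<psi>\<^sub>k(y\<^sup>k)\<close> (\<open>SUP_PiE_epigraph\<close>), while a suitable \<open>w\<^sup>k\<close> in the unit ball
  of the conjugate norm turns the bilinear coupling into the penalty term (\<open>norming_functional\<close>, the
  Hahn--Banach theorem). The maximized value is thus the penalized objective.

  The penalty is exact because replacing \<open>y\<^sup>k\<close> by \<open>A\<^sub>k y\<^sup>0 + b\<^sub>k\<close> raises \<open>\<psi>\<^sub>k + \<Psi>\<^sub>k\<close> by at most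
  \<open>G\<^sub>k + H\<^sub>k \<le> \<rho>\<^sub>k\<close> times the distance moved, which is what the disappearing penalty term pays for
  (\<open>composite_objective_le_penalized\<close>). So the correction never exceeds the penalized objective,
  whereas at points with \<open>y\<^sup>k = A\<^sub>k y\<^sup>0 + b\<^sub>k\<close> and
  \<open>\<tau>\<^sup>k = \<Psi>\<^sub>k(y\<^sup>k)\<close> both objectives agree; hence the equality of optimal values.

  For the accuracy bound, the first term of the gap is at least the penalized objective of the given
  primal point, hence at least the objective of its correction. The second term is at most the optimal
  value: at the point generated by any \<open>y\<^sup>0 \<in> Y\<^sub>0\<close> all couplings vanish, so no dual point
  can push the saddle function above \<open>f(y\<^sup>0)\<close>. This is weak duality.\<close>

section \<open>Norming functionals\<close>

text \<open>A functional separating the open ball of radius \<open>n d\<close> from its boundary point \<open>d\<close> is, after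
  scaling, the one sought. Separation in the ambient space could however produce a functional that
  vanishes on \<open>E\<close>; thickening the ball by the orthogonal complement of \<open>E\<close> forces the
  normal vector \<open>a\<close> into \<open>E\<close>. By homogeneity a small multiple of \<open>a\<close> then belongs to the
  ball, whence \<open>a \<bullet> d > 0\<close> and the scaling is possible.\<close>

lemma norming_functional:
  fixes E :: "'a::euclidean_space set"
  assumes E: "subspace E" and n: "norm_on_subspace E n" and d: "d \<in> E"
  shows "\<exists>w\<in>E. conjugate_norm E n w \<le> 1 \<and> w \<bullet> d = n d"
proof -
  have hom: "n (c *\<^sub>R x) = \<bar>c\<bar> * n x" if "x \<in> E" for c x
    using n that by (auto simp: norm_on_subspace_def)
  have tri: "n (x + y) \<le> n x + n y" if "x \<in> E" "y \<in> E" for x y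
    using n that by (auto simp: norm_on_subspace_def)
  have nonneg: "0 \<le> n x" if "x \<in> E" for x
    using n that by (auto simp: norm_on_subspace_def)
  have zero: "n x = 0 \<longleftrightarrow> x = 0" if "x \<in> E" for x
    using n that by (auto simp: norm_on_subspace_def)
  have E0: "0 \<in> E" by (rule subspace_0[OF E])
  have n0: "n 0 = 0" using zero E0 by simp
  have bound: "conjugate_norm E n w \<le> 1" if "\<And>y. y \<in> E \<Longrightarrow> n y \<le> 1 \<Longrightarrow> w \<bullet> y \<le> 1" for w
    unfolding conjugate_norm_def
  proof (rule cSUP_least)
    have "0 \<in> {y \<in> E. n y \<le> 1}" using E0 n0 by simp
    then show "{y \<in> E. n y \<le> 1} \<noteq> {}" by blast
  qed (use that in auto)
  show ?thesis
  proof (cases "d = 0")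
    case True
    have "conjugate_norm E n 0 \<le> 1" by (rule bound) simp
    then show ?thesis using True E0 n0 by auto
  next
    case False
    then have nd: "n d > 0" using nonneg zero d by (metis less_eq_real_def)
    define B where "B = {y \<in> E. n y < n d}"
    have "convex B"
    proof (rule convexI)
      fix x y and u v :: real
      assume xy: "x \<in> B" "y \<in> B" and uv: "0 \<le> u" "0 \<le> v" "u + v = 1"
      have xE: "x \<in> E" "y \<in> E" and lt: "n x < n d" "n y < n d" using xy by (auto simp: B_def)
      have "n (u *\<^sub>R x + v *\<^sub>R y) \<le> u * n x + v * n y"
        using tri[of "u *\<^sub>R x" "v *\<^sub>R y"] hom xE uv by (simp add: subspace_scale[OF E])
      also have "\<dots> < n d" using lt uv by (rule_tac convex_bound_lt) auto
      finally show "u *\<^sub>R x + v *\<^sub>R y \<in> B"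
        using xE by (simp add: B_def subspace_add[OF E] subspace_scale[OF E])
    qed
    define S where "S = B + orthogonal_comp E"
    have in_S: "x + y \<in> S" if "x \<in> E" "n x < n d" "y \<in> orthogonal_comp E" for x y
      using that by (auto simp: S_def B_def intro: set_plus_intro)
    have comp0: "0 \<in> orthogonal_comp E" by (simp add: subspace_0 subspace_orthogonal_comp)
    have BS: "x \<in> S" if "x \<in> E" "n x < n d" for x
      using in_S[OF that comp0] by simp
    have "convex S"
      unfolding S_def
      by (intro convex_set_plus \<open>convex B\<close> subspace_imp_convex subspace_orthogonal_comp)
    have "d \<notin> S"
    proof
      assume "d \<in> S"
      then obtain x y where xy: "d = x + y" "x \<in> E" "n x < n d" "y \<in> orthogonal_comp E"
        by (auto simp: S_def B_def elim!: set_plus_elim)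
      have "y \<in> E" using subspace_diff[OF E d xy(2)] xy(1) by simp
      then have "y = 0" using xy(4) by (auto simp: orthogonal_comp_def orthogonal_def)
      then show False using xy by simp
    qed
    moreover have "S \<noteq> {}" using BS[OF E0] n0 nd by auto
    ultimately obtain a c where a: "a \<noteq> 0" and S: "\<And>x. x \<in> S \<Longrightarrow> a \<bullet> x \<le> c" and "c \<le> a \<bullet> d"
      using separating_hyperplane_sets[OF \<open>convex S\<close> convex_singleton[of d]] by auto
    then have Sd: "a \<bullet> x \<le> a \<bullet> d" if "x \<in> S" for x using that by fastforce
    \<comment> \<open>A linear functional bounded above on a subspace vanishes there.\<close>
    have "a \<bullet> y = 0" if y: "y \<in> orthogonal_comp E" for y
    proof (rule ccontr)
      assume nz: "a \<bullet> y \<noteq> 0"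
      have "((a \<bullet> d + 1) / (a \<bullet> y)) *\<^sub>R y \<in> orthogonal_comp E"
        using y by (simp add: subspace_scale subspace_orthogonal_comp)
      then have "((a \<bullet> d + 1) / (a \<bullet> y)) *\<^sub>R y \<in> S"
        using in_S[OF E0] n0 nd by force
      from Sd[OF this] nz show False by simp
    qed
    then have "a \<in> orthogonal_comp (orthogonal_comp E)"
      by (auto simp: orthogonal_comp_def orthogonal_def inner_commute)
    then have aE: "a \<in> E" by (simp add: orthogonal_comp_self[OF E])
    then have na: "n a > 0" using nonneg zero a by (metis less_eq_real_def)
    have "(n d / (2 * n a)) *\<^sub>R a \<in> S"
      using aE na nd by (intro BS) (auto simp: subspace_scale[OF E] hom)
    from Sd[OF this] have "(n d / (2 * n a)) * (a \<bullet> a) \<le> a \<bullet> d" by simp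
    moreover have "(n d / (2 * n a)) * (a \<bullet> a) > 0" using a na nd by simp
    ultimately have ad: "a \<bullet> d > 0" by linarith
    define w where "w = (n d / (a \<bullet> d)) *\<^sub>R a"
    have "w \<bullet> y \<le> 1" if y: "y \<in> E" "n y \<le> 1" for y
    proof (rule ccontr)
      assume "\<not> w \<bullet> y \<le> 1"
      then have wy: "w \<bullet> y > 1" by simp
      define t where "t = n d / (w \<bullet> y)"
      have t: "0 < t" "t < n d" using wy nd by (auto simp: t_def field_simps)
      \<comment> \<open>The strict inequality leaves room: midway between \<open>t\<close> and \<open>n d\<close> the vector still lies
        in the ball, but already violates the separation.\<close>
      define s where "s = (t + n d) / 2"
      have s: "t < s" "s < n d" "0 < s" using t by (auto simp: s_def)
      have "s * n y \<le> s" using y s by (simp add: mult_left_le)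
      then have "n (s *\<^sub>R y) < n d" using s hom[OF y(1), of s] by linarith
      then have "s *\<^sub>R y \<in> S" by (intro BS subspace_scale[OF E] y)
      from Sd[OF this] have "s * (a \<bullet> y) \<le> a \<bullet> d" by simp
      then have "n d / (a \<bullet> d) * (s * (a \<bullet> y)) \<le> n d / (a \<bullet> d) * (a \<bullet> d)"
        using nd ad by (intro mult_left_mono) auto
      then have "s * (w \<bullet> y) \<le> n d" using ad by (simp add: w_def mult_ac)
      then have "s \<le> t" using wy by (simp add: t_def pos_le_divide_eq)
      then show False using s by simp
    qed
    then have "conjugate_norm E n w \<le> 1" by (rule bound)
    moreover have "w \<in> E" using aE by (simp add: w_def subspace_scale[OF E])
    moreover have "w \<bullet> d = n d" using ad by (simp add: w_def)
    ultimately show ?thesis by blast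
  qed
qed

section \<open>Partial maximization over products of epigraphs\<close>

text \<open>The variables are decoupled, and for each \<open>k\<close> the best choice of the second coordinate is the
  smallest admissible one, \<open>h k z\<close>; what remains is the representation of \<open>s k\<close>. As the
  suprema need not be attained, the total error is distributed evenly over the \<open>K + 1\<close> terms.\<close>

lemma SUP_PiE_epigraph:
  fixes g h :: "nat \<Rightarrow> 'b \<Rightarrow> real" and s t :: "nat \<Rightarrow> real" and c :: real
  assumes rep: "\<And>k. k \<le> K \<Longrightarrow> ereal (s k) = (SUP z\<in>Z k. ereal (g k z - h k z))"
  shows "(SUP x\<in>(\<Pi>\<^sub>E k\<in>{..K}. epigraph (Z k) (h k)).
            ereal ((\<Sum>k\<le>K. g k (fst (x k)) + t k - snd (x k)) + c)) =
          ereal ((\<Sum>k\<le>K. s k + t k) + c)" (is "?L = ?R")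
proof (rule antisym)
  have le: "g k z - h k z \<le> s k" if "k \<le> K" "z \<in> Z k" for k z
    using SUP_upper[OF that(2), of "\<lambda>z. ereal (g k z - h k z)"] rep[OF that(1)]
    by (metis ereal_less_eq(3))
  show "?L \<le> ?R"
  proof (rule SUP_least)
    fix x assume x: "x \<in> (\<Pi>\<^sub>E k\<in>{..K}. epigraph (Z k) (h k))"
    have "g k (fst (x k)) + t k - snd (x k) \<le> s k + t k" if "k \<le> K" for k
    proof -
      have "x k \<in> epigraph (Z k) (h k)" using PiE_mem[OF x] that by simp
      then have "fst (x k) \<in> Z k" "h k (fst (x k)) \<le> snd (x k)" by (auto simp: epigraph_def)
      then show ?thesis using le[OF that, of "fst (x k)"] by linarith
    qed
    then have "(\<Sum>k\<le>K. g k (fst (x k)) + t k - snd (x k)) \<le> (\<Sum>k\<le>K. s k + t k)"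
      by (intro sum_mono) auto
    then show "ereal ((\<Sum>k\<le>K. g k (fst (x k)) + t k - snd (x k)) + c) \<le> ?R" by simp
  qed
  show "?R \<le> ?L"
  proof (rule ereal_le_epsilon2)
    fix e :: real assume e: "0 < e"
    define \<delta> where "\<delta> = e / real (Suc K)"
    have \<delta>: "\<delta> > 0" using e by (simp add: \<delta>_def)
    have "\<exists>z\<in>Z k. s k - \<delta> < g k z - h k z" if k: "k \<le> K" for k
    proof -
      have "ereal (s k - \<delta>) < (SUP z\<in>Z k. ereal (g k z - h k z))"
        using rep[OF k] \<delta> by (metis diff_less_eq ereal_less(1) less_add_same_cancel1 less_ereal.simps(1))
      then show ?thesis by (auto simp: less_SUP_iff)
    qed
    then obtain z where z: "\<And>k. k \<le> K \<Longrightarrow> z k \<in> Z k"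
      "\<And>k. k \<le> K \<Longrightarrow> s k - \<delta> < g k (z k) - h k (z k)" by metis
    define x where "x = (\<lambda>k\<in>{..K}. (z k, h k (z k)))"
    have x: "x \<in> (\<Pi>\<^sub>E k\<in>{..K}. epigraph (Z k) (h k))"
      using z by (auto simp: x_def epigraph_def)
    have "(\<Sum>k\<le>K. s k + t k) \<le> (\<Sum>k\<le>K. (g k (fst (x k)) + t k - snd (x k)) + \<delta>)"
    proof (rule sum_mono)
      fix k assume "k \<in> {..K}"
      then show "s k + t k \<le> (g k (fst (x k)) + t k - snd (x k)) + \<delta>"
        using z(2)[of k] by (simp add: x_def)
    qed
    also have "\<dots> = (\<Sum>k\<le>K. g k (fst (x k)) + t k - snd (x k)) + e"
      by (simp add: sum.distrib \<delta>_def)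
    finally have "?R \<le> ereal ((\<Sum>k\<le>K. g k (fst (x k)) + t k - snd (x k)) + c) + ereal e" by simp
    also have "\<dots> \<le> ?L + ereal e" by (intro add_right_mono SUP_upper x)
    finally show "?R \<le> ?L + ereal e" .
  qed
qed

section \<open>Exact penalties\<close>

text \<open>Exactness of the penalty: moving \<open>y k\<close> to \<open>A k (y 0) + b k\<close> costs no more than the
  penalty that it removes, and lowering \<open>\<tau> k\<close> to the value of \<open>\<Psi> k\<close> costs nothing.\<close>

lemma composite_objective_le_penalized:
  assumes y: "\<And>k. k \<le> K \<Longrightarrow> y k \<in> Y k" and \<tau>: "\<And>k. k \<le> K \<Longrightarrow> \<Psi> k (y k) \<le> \<tau> k"
    and y0: "A 0 (y 0) + b 0 = y 0"
    and feas: "\<And>k. k \<in> {1..K} \<Longrightarrow> A k (y 0) + b k \<in> Y k"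
    and n: "\<And>k. k \<in> {1..K} \<Longrightarrow> 0 \<le> n k (y k - A k (y 0) - b k)"
    and \<psi>: "\<And>k. k \<in> {1..K} \<Longrightarrow> lipschitz_wrt (G k) (n k) (Y k) (\<psi> k)"
    and \<Psi>: "\<And>k. k \<in> {1..K} \<Longrightarrow> lipschitz_wrt (H k) (n k) (Y k) (\<Psi> k)"
    and \<rho>: "\<And>k. k \<in> {1..K} \<Longrightarrow> \<rho> k \<ge> G k + H k"
  shows "composite_objective K A b \<psi> \<Psi> (y 0) \<le>
    (\<Sum>k\<le>K. \<psi> k (y k) + \<tau> k) + (\<Sum>k=1..K. \<rho> k * n k (y k - A k (y 0) - b k))"
proof -
  have split: "(\<Sum>k\<le>K. u k) = u 0 + (\<Sum>k=1..K. u k)" for u :: "nat \<Rightarrow> real"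
    by (simp add: atMost_atLeast0 sum.atLeast_Suc_atMost)
  have "\<psi> k (A k (y 0) + b k) + \<Psi> k (A k (y 0) + b k) \<le>
          (\<psi> k (y k) + \<tau> k) + \<rho> k * n k (y k - A k (y 0) - b k)" if k: "k \<in> {1..K}" for k
  proof -
    have yk: "y k \<in> Y k" using y k by simp
    have eq: "y k - (A k (y 0) + b k) = y k - A k (y 0) - b k" by simp
    have "\<bar>\<psi> k (y k) - \<psi> k (A k (y 0) + b k)\<bar> \<le> G k * n k (y k - A k (y 0) - b k)"
      using \<psi>[OF k] yk feas[OF k] unfolding lipschitz_wrt_def eq[symmetric] by blast
    moreover have "\<bar>\<Psi> k (y k) - \<Psi> k (A k (y 0) + b k)\<bar> \<le> H k * n k (y k - A k (y 0) - b k)"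
      using \<Psi>[OF k] yk feas[OF k] unfolding lipschitz_wrt_def eq[symmetric] by blast
    moreover have "(G k + H k) * n k (y k - A k (y 0) - b k) \<le> \<rho> k * n k (y k - A k (y 0) - b k)"
      by (intro mult_right_mono \<rho>[OF k] n[OF k])
    moreover have "\<Psi> k (y k) \<le> \<tau> k" using \<tau> k by simp
    ultimately show ?thesis unfolding distrib_right by linarith
  qed
  then have "(\<Sum>k=1..K. \<psi> k (A k (y 0) + b k) + \<Psi> k (A k (y 0) + b k)) \<le>
      (\<Sum>k=1..K. \<psi> k (y k) + \<tau> k) + (\<Sum>k=1..K. \<rho> k * n k (y k - A k (y 0) - b k))"
    unfolding sum.distrib[symmetric] by (intro sum_mono) auto
  then show ?thesis
    unfolding composite_objective_def split using y0 \<tau>[of 0] by simp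
qed

section \<open>The penalized problem and the accuracy of corrected solutions\<close>

theorem proposition4p1:
  fixes K :: nat
    and E Y W :: "nat \<Rightarrow> 'a::euclidean_space set"
    and E' Z :: "nat \<Rightarrow> 'b::euclidean_space set"
    and p :: "nat \<Rightarrow> 'a \<Rightarrow> real" and q :: "nat \<Rightarrow> 'b \<Rightarrow> real"
    and \<omega> :: "nat \<Rightarrow> 'a \<Rightarrow> real" and \<omega>' :: "nat \<Rightarrow> 'b \<Rightarrow> real"
    and A :: "nat \<Rightarrow> 'a \<Rightarrow> 'a" and b :: "nat \<Rightarrow> 'a"
    and \<psi> \<Psi> :: "nat \<Rightarrow> 'a \<Rightarrow> real" and \<Psi>' :: "nat \<Rightarrow> 'b \<Rightarrow> real"
    and \<phi> :: "nat \<Rightarrow> 'a \<Rightarrow> 'b \<Rightarrow> real"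
    and \<pi>star \<pi> \<omega>hat :: "nat \<Rightarrow> 'a \<Rightarrow> real"
    and \<rho> G H :: "nat \<Rightarrow> real"
  defines "X1 \<equiv> primal_domain K Y \<Psi>"
    and "X2 \<equiv> dual_domain K Z \<Psi>' W"
    and "\<Phi> \<equiv> saddle_function K A b \<phi> \<rho>"
    and "f \<equiv> composite_objective K A b \<psi> \<Psi>"
    and "Opt \<equiv> composite_opt K A b Y \<psi> \<Psi>"
  assumes E: "\<And>k. k \<le> K \<Longrightarrow> subspace (E k)"
    and E': "\<And>k. k \<le> K \<Longrightarrow> subspace (E' k)"
    and Y: "\<And>k. k \<le> K \<Longrightarrow> Y k \<subseteq> E k \<and> Y k \<noteq> {} \<and> closed (Y k) \<and> convex (Y k)"
    and Z: "\<And>k. k \<le> K \<Longrightarrow> Z k \<subseteq> E' k \<and> Z k \<noteq> {} \<and> closed (Z k) \<and> convex (Z k)"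
    and p: "\<And>k. k \<le> K \<Longrightarrow> norm_on_subspace (E k) (p k)"
    and q: "\<And>k. k \<le> K \<Longrightarrow> norm_on_subspace (E' k) (q k)"
    and \<omega>: "\<And>k. k \<le> K \<Longrightarrow> continuously_differentiable_on (Y k) (\<omega> k) \<and>
              convex_on (Y k) (\<omega> k) \<and> strongly_convex_on (Y k) (p k) 1 (\<omega> k)"
    and \<omega>': "\<And>k. k \<le> K \<Longrightarrow> continuously_differentiable_on (Z k) (\<omega>' k) \<and>
              convex_on (Z k) (\<omega>' k) \<and> strongly_convex_on (Z k) (q k) 1 (\<omega>' k)"
    and A: "\<And>k. k \<le> K \<Longrightarrow> linear (A k) \<and> A k ` E 0 \<subseteq> E k \<and> b k \<in> E k"
    and A0: "\<And>y. y \<in> E 0 \<Longrightarrow> A 0 y + b 0 = y"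
    and \<psi>: "\<And>k. k \<le> K \<Longrightarrow> convex_on (Y k) (\<psi> k) \<and> (\<exists>L. L-lipschitz_on (Y k) (\<psi> k))"
    and \<psi>_rep: "\<And>k y. k \<le> K \<Longrightarrow> y \<in> Y k \<Longrightarrow>
              ereal (\<psi> k y) = (SUP z\<in>Z k. ereal (\<phi> k y z - \<Psi>' k z))"
    and \<phi>_smooth: "\<And>k. k \<le> K \<Longrightarrow> lipschitz_gradient_on (Y k \<times> Z k) (\<lambda>(y, z). \<phi> k y z)"
    and \<phi>_convex: "\<And>k z. k \<le> K \<Longrightarrow> z \<in> Z k \<Longrightarrow> convex_on (Y k) (\<lambda>y. \<phi> k y z)"
    and \<phi>_concave: "\<And>k y. k \<le> K \<Longrightarrow> y \<in> Y k \<Longrightarrow> concave_on (Z k) (\<lambda>z. \<phi> k y z)"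
    and \<Psi>': "\<And>k. k \<le> K \<Longrightarrow> convex_on (Z k) (\<Psi>' k) \<and> (\<exists>L. L-lipschitz_on (Z k) (\<Psi>' k))"
    and \<Psi>: "\<And>k. k \<le> K \<Longrightarrow> convex_on (Y k) (\<Psi> k) \<and> (\<exists>L. L-lipschitz_on (Y k) (\<Psi> k))"
    and \<pi>star: "\<And>k. k \<in> {1..K} \<Longrightarrow> norm_on_subspace (E k) (\<pi>star k)"
    and \<pi>: "\<And>k w. k \<in> {1..K} \<Longrightarrow> w \<in> E k \<Longrightarrow> \<pi> k w = conjugate_norm (E k) (\<pi>star k) w"
    and W: "\<And>k. k \<in> {1..K} \<Longrightarrow> W k = {w \<in> E k. \<pi> k w \<le> 1}"
    and \<omega>hat: "\<And>k. k \<in> {1..K} \<Longrightarrow> continuously_differentiable_on (W k) (\<omega>hat k) \<and>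
              strongly_convex_on (W k) (\<pi> k) 1 (\<omega>hat k)"
    and \<rho>_pos: "\<And>k. k \<in> {1..K} \<Longrightarrow> \<rho> k > 0"
    and B1: "\<And>k y. k \<in> {1..K} \<Longrightarrow> y \<in> Y 0 \<Longrightarrow> A k y + b k \<in> Y k"
    and B2_bounded: "\<And>k. k \<le> K \<Longrightarrow> bounded (Z k)"
    and B2_below: "\<And>k. k \<le> K \<Longrightarrow> bdd_below (\<Psi> k ` Y k)"
    and B2_coercive: "\<And>k y. k \<le> K \<Longrightarrow> (\<forall>t::nat. y t \<in> Y k) \<Longrightarrow>
              filterlim (\<lambda>t. p k (y t)) at_top sequentially \<Longrightarrow>
              filterlim (\<lambda>t. \<psi> k (y t) + \<Psi> k (y t)) at_top sequentially"
    and C_\<psi>: "\<And>k. k \<in> {1..K} \<Longrightarrow> lipschitz_wrt (G k) (\<pi>star k) (Y k) (\<psi> k)"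
    and C_\<Psi>: "\<And>k. k \<in> {1..K} \<Longrightarrow> lipschitz_wrt (H k) (\<pi>star k) (Y k) (\<Psi> k)"
    and \<rho>_ge: "\<And>k. k \<in> {1..K} \<Longrightarrow> \<rho> k \<ge> G k + H k"
  shows "penalized_opt K A b Y Z \<phi> \<Psi> \<Psi>' \<rho> \<pi>star = Opt \<and>
    (\<forall>x1\<in>X1. \<forall>x2\<in>X2. let xhat = correction K A b \<Psi> x1 in
      (\<forall>k\<le>K. xhat k \<in> epigraph (Y k) (\<Psi> k)) \<and>
      (\<forall>k\<in>{1..K}. fst (xhat k) = A k (fst (xhat 0)) + b k) \<and>
      ereal (f (fst (xhat 0))) - Opt \<le> saddle_gap X1 X2 \<Phi> x1 x2)"
proof -
  have Y0: "A 0 y + b 0 = y" if "y \<in> Y 0" for y using Y[of 0] A0 that by auto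
  have AY: "A k y + b k \<in> Y k" if "k \<le> K" "y \<in> Y 0" for k y
    using that Y0 B1[of k] by (cases "k = 0") auto
  have X1_iff: "x1 \<in> X1 \<Longrightarrow> k \<le> K \<Longrightarrow> fst (x1 k) \<in> Y k \<and> \<Psi> k (fst (x1 k)) \<le> snd (x1 k)" for x1 k
    unfolding X1_def primal_domain_def epigraph_def by (auto simp: PiE_iff)
  have resE: "fst (x1 k) - A k (fst (x1 0)) - b k \<in> E k" if "x1 \<in> X1" "k \<in> {1..K}" for x1 k
  proof -
    have k: "k \<le> K" using that by simp
    have "fst (x1 k) \<in> E k" "fst (x1 0) \<in> E 0"
      using X1_iff[OF that(1)] Y k by blast+
    then show ?thesis using A[OF k] E[OF k] by (intro subspace_diff) auto
  qed
  define P where "P x1 = (\<Sum>k=1..K. \<rho> k * \<pi>star k (fst (x1 k) - A k (fst (x1 0)) - b k))"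
    for x1 :: "nat \<Rightarrow> 'a \<times> real"
  define V where "V x1 = (\<Sum>k\<le>K. \<psi> k (fst (x1 k)) + snd (x1 k)) + P x1" for x1
  have inner: "(SUP x2\<in>(\<Pi>\<^sub>E k\<in>{..K}. epigraph (Z k) (\<Psi>' k)).
      ereal ((\<Sum>k\<le>K. \<phi> k (fst (x1 k)) (fst (x2 k)) + snd (x1 k) - snd (x2 k)) + P x1)) =
      ereal (V x1)" if "x1 \<in> X1" for x1
    unfolding V_def
    by (rule SUP_PiE_epigraph[where g = "\<lambda>k. \<phi> k (fst (x1 k))"])
      (use X1_iff[OF that] \<psi>_rep in blast)
  have pen: "penalized_opt K A b Y Z \<phi> \<Psi> \<Psi>' \<rho> \<pi>star = (INF x1\<in>X1. ereal (V x1))"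
    unfolding penalized_opt_def using inner
    by (auto simp: P_def X1_def primal_domain_def intro!: INF_cong)
  have f_le_V: "f (fst (x1 0)) \<le> V x1" if x1: "x1 \<in> X1" for x1
    unfolding f_def V_def P_def
  proof (rule composite_objective_le_penalized[where y = "\<lambda>k. fst (x1 k)" and Y = Y and G = G and H = H])
    show "0 \<le> \<pi>star k (fst (x1 k) - A k (fst (x1 0)) - b k)" if "k \<in> {1..K}" for k
      using \<pi>star[OF that] resE[OF x1 that] by (auto simp: norm_on_subspace_def)
  qed (use X1_iff[OF x1] Y0 B1 C_\<psi> C_\<Psi> \<rho>_ge in auto)

  \<comment> \<open>The point of \<open>X1\<close> generated by \<open>y \<in> Y 0\<close>: all penalties and couplings vanish there.\<close>
  define lift where "lift y = (\<lambda>k\<in>{..K}. (A k y + b k, \<Psi> k (A k y + b k)))" for y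
  have lift_in: "lift y \<in> X1" if "y \<in> Y 0" for y
    using AY[OF _ that] by (auto simp: X1_def primal_domain_def lift_def epigraph_def)
  have lift0: "fst (lift y 0) = y" if "y \<in> Y 0" for y
    using Y0[OF that] by (simp add: lift_def)
  have lift_res: "fst (lift y k) - A k (fst (lift y 0)) - b k = 0" if "y \<in> Y 0" "k \<in> {1..K}" for y k
    unfolding lift0[OF that(1)] using that(2) by (simp add: lift_def)
  have lift_V: "V (lift y) = f y" if y: "y \<in> Y 0" for y
  proof -
    have "\<pi>star k 0 = 0" if "k \<in> {1..K}" for k
    proof -
      have "0 \<in> E k" using E[of k] that by (simp add: subspace_0)
      then show ?thesis using \<pi>star[OF that] by (auto simp: norm_on_subspace_def)
    qed
    then have "P (lift y) = 0" unfolding P_def using lift_res[OF y] by (intro sum.neutral) auto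
    then show ?thesis by (simp add: V_def f_def composite_objective_def lift_def)
  qed

  have "Opt \<le> (INF x1\<in>X1. ereal (V x1))"
  proof (rule INF_greatest)
    fix x1 assume x1: "x1 \<in> X1"
    have "Opt \<le> ereal (f (fst (x1 0)))"
      unfolding Opt_def composite_opt_def f_def using X1_iff[OF x1, of 0] by (intro INF_lower) simp
    then show "Opt \<le> ereal (V x1)" using f_le_V[OF x1] by (meson ereal_less_eq(3) order_trans)
  qed
  moreover have "(INF x1\<in>X1. ereal (V x1)) \<le> Opt"
    unfolding Opt_def composite_opt_def f_def[symmetric]
  proof (rule INF_greatest)
    fix y assume y: "y \<in> Y 0"
    show "(INF x1\<in>X1. ereal (V x1)) \<le> ereal (f y)"
      using INF_lower[OF lift_in[OF y], of "\<lambda>x1. ereal (V x1)"] lift_V[OF y] by simp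
  qed
  ultimately have opt: "penalized_opt K A b Y Z \<phi> \<Psi> \<Psi>' \<rho> \<pi>star = Opt" by (simp add: pen)

  have upper: "ereal (V x1) \<le> (SUP x2\<in>X2. ereal (\<Phi> x1 x2))" if x1: "x1 \<in> X1" for x1
  proof -
    have "\<exists>w\<in>W k. w \<bullet> (fst (x1 k) - A k (fst (x1 0)) - b k) =
        \<pi>star k (fst (x1 k) - A k (fst (x1 0)) - b k)" if k: "k \<in> {1..K}" for k
      using norming_functional[OF E \<pi>star[OF k] resE[OF x1 k]] k by (auto simp: W \<pi>)
    then obtain w where w: "\<And>k. k \<in> {1..K} \<Longrightarrow> w k \<in> W k"
      "\<And>k. k \<in> {1..K} \<Longrightarrow> w k \<bullet> (fst (x1 k) - A k (fst (x1 0)) - b k) =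
        \<pi>star k (fst (x1 k) - A k (fst (x1 0)) - b k)" by metis
    define w' where "w' = restrict w {1..K}"
    have w': "w' \<in> (\<Pi>\<^sub>E k\<in>{1..K}. W k)" using w by (auto simp: w'_def)
    have \<Phi>: "\<Phi> x1 (u, w') =
        (\<Sum>k\<le>K. \<phi> k (fst (x1 k)) (fst (u k)) + snd (x1 k) - snd (u k)) + P x1" for u
    proof -
      have "(\<Sum>k=1..K. \<rho> k * (w' k \<bullet> (fst (x1 k) - A k (fst (x1 0)) - b k))) = P x1"
        unfolding P_def using w(2) by (intro sum.cong) (auto simp: w'_def)
      then show ?thesis by (simp add: \<Phi>_def saddle_function_def)
    qed
    show ?thesis unfolding inner[OF x1, symmetric]
    proof (rule SUP_least)
      fix u assume "u \<in> (\<Pi>\<^sub>E k\<in>{..K}. epigraph (Z k) (\<Psi>' k))"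
      then have "(u, w') \<in> X2" using w' by (simp add: X2_def dual_domain_def)
      from SUP_upper[OF this, of "\<lambda>x2. ereal (\<Phi> x1 x2)"]
      show "ereal ((\<Sum>k\<le>K. \<phi> k (fst (x1 k)) (fst (u k)) + snd (x1 k) - snd (u k)) + P x1)
          \<le> (SUP x2\<in>X2. ereal (\<Phi> x1 x2))" by (simp add: \<Phi>)
    qed
  qed

  have lower: "(INF x1\<in>X1. ereal (\<Phi> x1 x2)) \<le> Opt" if x2: "x2 \<in> X2" for x2
    unfolding Opt_def composite_opt_def f_def[symmetric]
  proof (rule INF_greatest)
    fix y assume y: "y \<in> Y 0"
    obtain u w where uw: "x2 = (u, w)" "u \<in> (\<Pi>\<^sub>E k\<in>{..K}. epigraph (Z k) (\<Psi>' k))"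
      using x2 by (auto simp: X2_def dual_domain_def)
    have "(\<Sum>k=1..K. \<rho> k * (w k \<bullet> (fst (lift y k) - A k (fst (lift y 0)) - b k))) = 0"
      using lift_res[OF y] by (intro sum.neutral) auto
    moreover have "P (lift y) = 0"
      using lift_V[OF y] by (simp add: V_def f_def composite_objective_def lift_def)
    ultimately have "\<Phi> (lift y) x2 =
        (\<Sum>k\<le>K. \<phi> k (fst (lift y k)) (fst (u k)) + snd (lift y k) - snd (u k)) + P (lift y)"
      by (simp add: \<Phi>_def saddle_function_def uw(1))
    then have "ereal (\<Phi> (lift y) x2) \<le> ereal (V (lift y))"
      unfolding inner[OF lift_in[OF y], symmetric] using SUP_upper[OF uw(2)] by simp
    then have "ereal (\<Phi> (lift y) x2) \<le> ereal (f y)" by (simp add: lift_V[OF y])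
    then show "(INF x1\<in>X1. ereal (\<Phi> x1 x2)) \<le> ereal (f y)"
      by (rule INF_lower2[OF lift_in[OF y]])
  qed

  have corr: "correction K A b \<Psi> x1 = lift (fst (x1 0))" if "x1 \<in> X1" for x1
    using Y0[of "fst (x1 0)"] X1_iff[OF that, of 0]
    by (auto simp: correction_def lift_def Let_def fun_eq_iff)
  show ?thesis
  proof (intro conjI opt ballI)
    fix x1 x2 assume x1: "x1 \<in> X1" and x2: "x2 \<in> X2"
    define y where "y = fst (x1 0)"
    have y: "y \<in> Y 0" using X1_iff[OF x1, of 0] by (simp add: y_def)
    have "lift y k \<in> epigraph (Y k) (\<Psi> k)" if "k \<le> K" for k
      using X1_iff[OF lift_in[OF y] that] by (simp add: epigraph_def)
    moreover have "fst (lift y k) = A k (fst (lift y 0)) + b k" if "k \<in> {1..K}" for k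
      using lift_res[OF y that] by (simp add: algebra_simps)
    moreover have "ereal (f y) - Opt \<le> saddle_gap X1 X2 \<Phi> x1 x2"
      unfolding saddle_gap_def
    proof (rule ereal_minus_mono)
      show "ereal (f y) \<le> (SUP x2\<in>X2. ereal (\<Phi> x1 x2))"
        using f_le_V[OF x1] upper[OF x1] unfolding y_def by (meson ereal_less_eq(3) order_trans)
    qed (rule lower[OF x2])
    ultimately show "let xhat = correction K A b \<Psi> x1 in
      (\<forall>k\<le>K. xhat k \<in> epigraph (Y k) (\<Psi> k)) \<and>
      (\<forall>k\<in>{1..K}. fst (xhat k) = A k (fst (xhat 0)) + b k) \<and>
      ereal (f (fst (xhat 0))) - Opt \<le> saddle_gap X1 X2 \<Phi> x1 x2"
      by (simp add: corr[OF x1] y_def[symmetric] lift0[OF y])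
  qed
qed

end
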